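(* Let $N\ge 1$ and let $\Phi:\mathbb{R}\to\mathbb{R}$ be a $C^1$ function. Assume that the function $t\mapsto t^{N-1}\,\Phi'(t)^N$ is invertible on the interval $(a,b)$, and let $\psi:(a',b')\to\mathbb{R}$ be its inverse. Set $\Omega=\{x : a<\det x<b\}$ and $\Sigma=\{y : a'<\det y<b'\}$, where $x$ and $y$ range over real $N\times N$ matrices. Then the function $F:\Omega\to\mathbb{R}$ given by $F(x)=\Phi(\det x)$ has a Legendre transform $F^L:\Sigma\to\mathbb{R}$, given by $$F^L(y)=N\,\Phi'(\psi(\det y))\,\psi(\det y)-\Phi(\psi(\det y)).$$
   Context: Matrices $x=(x_n^k)$ and $y=(y_k^n)$ of size $N\times N$ are paired by $\langle x,y\rangle=\sum_{n,k}x_n^k y_k^n$, and the derivative $F'(x)$ is the matrix with entries $y_k^n=\partial F/\partial x_n^k$. Definition (Legendre transform). Let $X$ be a finite-dimensional real vector space with dual $Y$ and duality pairing $\langle x,y\rangle$. Let $F:\Omega\to\mathbb{R}$ be a $C^1$ function, where $\Omega$ is a submanifold of $X$, and set $\Sigma=F'(\Omega)$. A $C^1$ function $G:\Sigma\to\mathbb{R}$ is the Legendre transform of $F$, denoted $F^L$, if $\Sigma$ is a submanifold of $Y$ and $$[x\in\Omega,\ y=F'(x)]\ \Longrightarrow\ \langle x,y\rangle-F(x)=G(y).$$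
   Formalization: The full Legendre transform claim (Σ = F'(Ω), F^L of class C¹) is stated only if 0 ∉ (a',b'), or N = 1, or N = 2 and Φ'(0) ≠ 0; otherwise it is false, and only F'(Ω) ⊆ Σ and the formula ⟨x,F'(x)⟩ − F(x) = F^L(F'(x)) are claimed. *)

theory Defs
  imports "HOL-Analysis.Analysis"
begin

(* A function on an arbitrary subset S of a Euclidean space is C1 if it extends, near each point
   of S, to a C1 function on an open set. If S is open, this is the usual notion. *)
definition C1_on :: "'a::euclidean_space set \<Rightarrow> ('a \<Rightarrow> 'b::euclidean_space) \<Rightarrow> bool" where
  "C1_on S f \<longleftrightarrow>
    (\<forall>p\<in>S. \<exists>U g. \<exists>g' :: 'a \<Rightarrow> 'a \<Rightarrow>\<^sub>L 'b.
       open U \<and> p \<in> U \<and>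
       (\<forall>x\<in>U. (g has_derivative blinfun_apply (g' x)) (at x)) \<and>
       continuous_on U g' \<and>
       (\<forall>x\<in>S \<inter> U. g x = f x))"

(* Embedded C1 submanifolds: locally straightened to a d-dimensional linear subspace. *)
definition C1_submanifold :: "'a::euclidean_space set \<Rightarrow> bool" where
  "C1_submanifold S \<longleftrightarrow>
    (\<exists>d. \<forall>p\<in>S. \<exists>U V L. \<exists>f g :: 'a \<Rightarrow> 'a.
       open U \<and> p \<in> U \<and> open V \<and> homeomorphism U V f g \<and> C1_on U f \<and> C1_on V g \<and>
       subspace L \<and> dim L = d \<and> f ` (S \<inter> U) = L \<inter> V)"

(* B identifies 'b with the dual of 'a, y acting as the functional h |-> B h y. *)
definition duality_pairing ::
    "('a::euclidean_space \<Rightarrow> 'b::euclidean_space \<Rightarrow> real) \<Rightarrow> bool" where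
  "duality_pairing B \<longleftrightarrow> bilinear B \<and>
    (\<forall>x. (\<forall>y. B x y = 0) \<longrightarrow> x = 0) \<and> (\<forall>y. (\<forall>x. B x y = 0) \<longrightarrow> y = 0)"

(* y = F'(x), as an element of the dual. If x is an interior point of \<Omega>, there is at most one
   such y; on a lower-dimensional \<Omega>, y is determined only up to the annihilator of the
   tangent space, and all representatives are allowed. *)
definition has_dual_derivative ::
    "('a::euclidean_space \<Rightarrow> 'b::euclidean_space \<Rightarrow> real) \<Rightarrow> 'a set \<Rightarrow> ('a \<Rightarrow> real) \<Rightarrow> 'a \<Rightarrow> 'b \<Rightarrow> bool" where
  "has_dual_derivative B \<Omega> F x y \<longleftrightarrow> (F has_derivative (\<lambda>h. B h y)) (at x within \<Omega>)"

(* G, on \<Sigma>, is the Legendre transform of F, on \<Omega>. *)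
definition legendre_transform ::
    "('a::euclidean_space \<Rightarrow> 'b::euclidean_space \<Rightarrow> real) \<Rightarrow>
     'a set \<Rightarrow> ('a \<Rightarrow> real) \<Rightarrow> 'b set \<Rightarrow> ('b \<Rightarrow> real) \<Rightarrow> bool" where
  "legendre_transform B \<Omega> F \<Sigma> G \<longleftrightarrow>
    duality_pairing B \<and>
    C1_submanifold \<Omega> \<and> C1_on \<Omega> F \<and>
    \<Sigma> = {y. \<exists>x\<in>\<Omega>. has_dual_derivative B \<Omega> F x y} \<and>
    C1_submanifold \<Sigma> \<and> C1_on \<Sigma> G \<and>
    (\<forall>x y. x \<in> \<Omega> \<and> has_dual_derivative B \<Omega> F x y \<longrightarrow> B x y - F x = G y)"

(* The trace of x ** y: the row index of x is paired with the column index of y, so the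
   derivative of F is the transpose of its gradient for the standard inner product. *)
definition matrix_pairing :: "real^'n^'n \<Rightarrow> real^'n^'n \<Rightarrow> real" where
  "matrix_pairing x y = (\<Sum>n\<in>UNIV. \<Sum>k\<in>UNIV. x $ n $ k * y $ k $ n)"

lemma has_dual_derivative_matrix_entry:
  fixes F :: "real^'n^'n \<Rightarrow> real"
  assumes "open \<Omega>" "x \<in> \<Omega>" and D: "has_dual_derivative matrix_pairing \<Omega> F x y"
  shows "((\<lambda>t. F (x + t *\<^sub>R axis n (axis k 1))) has_real_derivative y $ k $ n) (at 0)"
proof -
  let ?E = "axis n (axis k 1) :: real^'n^'n"
  have F': "(F has_derivative (\<lambda>h. matrix_pairing h y)) (at x)"
    using D at_within_open[OF assms(2,1)] by (simp add: has_dual_derivative_def)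
  have l: "((\<lambda>t. x + t *\<^sub>R ?E) has_derivative (\<lambda>t. 0 + t *\<^sub>R ?E)) (at 0)"
    by (intro has_derivative_add has_derivative_const has_derivative_scaleR_left has_derivative_ident)
  have e: "matrix_pairing (0 + t *\<^sub>R ?E) y = y $ k $ n * t" for t
  proof -
    have "(t *\<^sub>R ?E) $ i $ j * y $ j $ i = (if j = k then (if i = n then t * y $ k $ n else 0) else 0)"
      for i j by (simp add: axis_def)
    then show ?thesis unfolding matrix_pairing_def by (simp add: mult.commute)
  qed
  have "((\<lambda>t. F (x + t *\<^sub>R ?E)) has_derivative (\<lambda>t. matrix_pairing (0 + t *\<^sub>R ?E) y)) (at 0)"
    by (rule has_derivative_compose[OF l, of F "\<lambda>h. matrix_pairing h y"]) (simp add: F')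
  then show ?thesis
    unfolding has_field_derivative_def e .
qed

end

theory Submission
  imports Defs
begin

text \<open>
  The derivative of \<open>\<Phi> \<circ> det\<close> at x is y = \<open>\<Phi>'(t) adj x\<close> with t = det x. Hence
  \<open>\<langle>x, y\<rangle> = N \<Phi>'(t) t\<close> and \<open>det y = \<Phi>'(t)\<^sup>N det (adj x) = t\<^bsup>N - 1\<^esup> \<Phi>'(t)\<^sup>N\<close>, which gives the formula
  after inverting this function of t.

  The delicate point is that the transform is again C1 although \<open>\<psi>\<close> is merely continuous. If f has
  a continuous injective derivative q, then by the mean value theorem the increment of
  q(r) r - f(r) differs from r times the increment of q by at most the product of the
  increments of r and q. So the one-dimensional Legendre transform is differentiable in the
  variable q, with derivative r. This is applied to \<open>f(r) = \<Phi>(\<plusminus> r\<^sup>N)\<close>, the restriction of F to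
  the positive multiples of a fixed matrix of determinant \<open>\<plusminus>1\<close>.
\<close>

subsection \<open>The adjugate matrix\<close>

text \<open>Cofactors are written as determinants with one row replaced by a unit vector, which
  avoids minors over a smaller index type.\<close>

definition adjugate :: "real^'n^'n \<Rightarrow> real^'n^'n" where
  "adjugate x = (\<chi> k n. det (\<chi> i. if i = n then axis k 1 else x $ i))"

text \<open>Laplace expansion: write \<open>v\<close> in the standard basis and use linearity of
  \<open>det\<close> in row \<open>n\<close>.\<close>

lemma adjugate_expansion_row:
  "(\<Sum>k\<in>UNIV. v $ k * adjugate x $ k $ n) = det (\<chi> i. if i = n then v else x $ i)"
proof -
  have "det (\<chi> i. if i = n then v else x $ i)
      = det (\<chi> i. if i = n then (\<Sum>k\<in>UNIV. v $ k *s axis k 1) else x $ i)"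
    by (simp add: basis_expansion cong: if_cong)
  also have "\<dots> = (\<Sum>k\<in>UNIV. det (\<chi> i. if i = n then v $ k *s axis k 1 else x $ i))"
    by (rule det_linear_row_sum) simp
  also have "\<dots> = (\<Sum>k\<in>UNIV. v $ k * adjugate x $ k $ n)"
    unfolding det_row_mul by (simp add: adjugate_def)
  finally show ?thesis by simp
qed

text \<open>By the row expansion, entry (m, n) is the determinant of \<open>x\<close> with row n
  replaced by row m; off the diagonal two rows coincide.\<close>

lemma matrix_mul_adjugate: "x ** adjugate x = det x *\<^sub>R mat 1"
proof -
  have "(\<Sum>k\<in>UNIV. x $ m $ k * adjugate x $ k $ n) = (if m = n then det x else 0)" for m n
  proof (cases "m = n")
    case True
    then have "(\<chi> i. if i = n then x $ n else x $ i) = x" by (simp add: vec_eq_iff)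
    with True show ?thesis by (simp add: adjugate_expansion_row)
  next
    case False
    then have "row m (\<chi> i. if i = n then x $ m else x $ i)
        = row n (\<chi> i. if i = n then x $ m else x $ i)"
      by (simp add: row_def)
    with False show ?thesis
      using det_identical_rows[OF False] by (simp add: adjugate_expansion_row)
  qed
  then show ?thesis by (simp add: vec_eq_iff matrix_matrix_mult_def mat_def)
qed

lemma matrix_pairing_adjugate: "matrix_pairing x (adjugate x) = real CARD('n) * det x"
  for x :: "real^'n^'n"
proof -
  have "(\<Sum>k\<in>UNIV. x $ n $ k * adjugate x $ k $ n) = (x ** adjugate x) $ n $ n" for n
    by (simp add: matrix_matrix_mult_def)
  then show ?thesis
    unfolding matrix_pairing_def matrix_mul_adjugate by (simp add: mat_def)
qed

lemma det_scaleR: "det (c *\<^sub>R x) = c ^ CARD('n) * det x" for x :: "real^'n^'n"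
proof -
  have "c *\<^sub>R x = (\<chi> i. c *s x $ i)" by (simp add: vec_eq_iff)
  then show ?thesis using det_rows_mul[of "\<lambda>_. c" "\<lambda>i. x $ i"] by simp
qed

lemma adjugate_eqI:
  assumes "det x \<noteq> 0" "x ** y = det x *\<^sub>R mat 1"
  shows "adjugate x = y"
proof -
  obtain z where z: "z ** x = mat 1"
    using assms(1) by (metis invertible_det_nz invertible_def)
  have "z ** (x ** adjugate x) = z ** (x ** y)"
    by (simp add: assms(2) matrix_mul_adjugate)
  then show ?thesis by (simp add: matrix_mul_assoc z)
qed

lemma adjugate_card_1:
  fixes x :: "real^'n^'n"
  assumes "CARD('n) = 1"
  shows "adjugate x = mat 1"
proof -
  obtain a :: 'n where "UNIV = {a}"
    using assms by (rule card_1_singletonE)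
  then have s: "i = a" for i :: 'n by blast
  \<comment> \<open>The only row is the replaced one, so the adjugate does not depend on
    \<open>x\<close> and can be computed at \<open>mat 1\<close>.\<close>
  have "(\<chi> i. if i = n then axis k 1 else x $ i) = (\<chi> i. if i = n then axis k 1 else mat 1 $ i)"
    for n k unfolding vec_eq_iff vec_lambda_beta using s by metis
  then have "adjugate x = adjugate (mat 1)"
    by (simp add: adjugate_def)
  also have "\<dots> = mat 1"
    using matrix_mul_adjugate[of "mat 1 :: real^'n^'n"] by simp
  finally show ?thesis .
qed

text \<open>For nonsingular \<open>x\<close>, take determinants in
  \<open>matrix_mul_adjugate\<close> and cancel. For singular \<open>x\<close> and N > 1, an
  invertible adjugate would force \<open>x = 0\<close>, whose adjugate vanishes. For N = 1 the
  adjugate is the identity, in agreement with exponent 0.\<close>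

lemma det_adjugate: "det (adjugate x) = det x ^ (CARD('n) - 1)" for x :: "real^'n^'n"
proof (cases "det x = 0")
  case False
  have "det x * det (adjugate x) = det x ^ CARD('n)"
    unfolding det_mul[symmetric] matrix_mul_adjugate det_scaleR by simp
  also have "\<dots> = det x * det x ^ (CARD('n) - 1)"
    by (simp flip: power_Suc)
  finally show ?thesis using False by simp
next
  case True
  show ?thesis
  proof (cases "CARD('n) = 1")
    case True
    then show ?thesis by (simp add: adjugate_card_1)
  next
    case False
    then have N: "CARD('n) > 1" using zero_less_card_finite[where ?'a='n] by linarith
    have "det (adjugate x) = 0"
    proof (rule ccontr)
      assume nz: "det (adjugate x) \<noteq> 0"
      then have "invertible (adjugate x)" by (simp add: invertible_det_nz)
      then obtain z where z: "adjugate x ** z = mat 1" by (auto simp: invertible_def)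
      have "x = (x ** adjugate x) ** z"
        by (simp add: z flip: matrix_mul_assoc)
      then have x0: "x = 0" by (simp add: matrix_mul_adjugate True)
      have "adjugate x $ k $ n = 0" for k n
      proof -
        have "UNIV \<noteq> {n}" using N by (metis card_1_singleton_iff One_nat_def less_irrefl)
        then obtain m where m: "m \<noteq> n" by blast
        have "row m (\<chi> i. if i = n then axis k 1 else x $ i) = 0"
          using m x0 by (simp add: row_def vec_eq_iff)
        from det_zero_row(1)[OF this] show ?thesis by (simp add: adjugate_def)
      qed
      then have "adjugate x = 0" by (simp add: vec_eq_iff)
      then have "row n (adjugate x) = 0" for n by (simp add: row_def vec_eq_iff)
      then show False using nz det_zero_row(1) by blast
    qed
    with True N show ?thesis by simp
  qed
qed

text \<open>In size 2 the adjugate is linear and an involution, on singular matrices too. This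
  supplies preimages of singular \<open>y\<close>.\<close>

lemma adjugate_scaleR_adjugate_card_2:
  fixes x :: "real^'n^'n"
  assumes "CARD('n) = 2"
  shows "adjugate (c *\<^sub>R adjugate x) = c *\<^sub>R x"
proof -
  obtain i j :: 'n where ij: "UNIV = {i, j}" "i \<noteq> j"
    using assms by (metis card_2_iff)
  have f: "finite {j}" "i \<notin> {j}" using ij by auto
  have d: "det A = A $ i $ i * A $ j $ j - A $ i $ j * A $ j $ i" for A :: "real^'n^'n"
    unfolding det_def ij(1) sum_over_permutations_insert[OF f] permutes_sing
    using ij(2) by (simp add: sign_swap_id sign_id transpose_def)
  have all: "(\<forall>k. P k) \<longleftrightarrow> P i \<and> P j" for P
    using ij(1) by (metis (full_types) UNIV_I empty_iff insertE)
  show ?thesis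
    using ij(2) by (simp add: vec_eq_iff adjugate_def d all axis_def)
qed

text \<open>Jacobi's formula, by applying the product rule to each term of the Leibniz sum.\<close>

lemma has_derivative_det:
  "(det has_derivative (\<lambda>h. matrix_pairing h (adjugate x))) (at x)" for x :: "real^'n^'n"
proof -
  \<comment> \<open>Brings the pairing into the shape that the product rule yields: row n of
    \<open>h\<close> replaces row n of \<open>x\<close>, summed over n.\<close>
  have r: "matrix_pairing h (adjugate x) = (\<Sum>p | p permutes UNIV.
      of_int (sign p) * (\<Sum>n\<in>UNIV. h $ n $ p n * (\<Prod>i\<in>UNIV - {n}. x $ i $ p i)))" for h
  proof -
    have "(\<Prod>i\<in>UNIV. (\<chi> i. if i = n then h $ n else x $ i) $ i $ p i)
        = h $ n $ p n * (\<Prod>i\<in>UNIV - {n}. x $ i $ p i)" for n and p :: "'n \<Rightarrow> 'n"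
      by (subst prod.remove[of _ n]) (auto intro!: prod.cong)
    then have "det (\<chi> i. if i = n then h $ n else x $ i) = (\<Sum>p | p permutes UNIV.
      of_int (sign p) * (h $ n $ p n * (\<Prod>i\<in>UNIV - {n}. x $ i $ p i)))" for n
      unfolding det_def by presburger
    then show ?thesis
      unfolding matrix_pairing_def adjugate_expansion_row
      by (simp only: sum_distrib_left) (rule sum.swap)
  qed
  show ?thesis
    unfolding r det_def[abs_def]
    by (intro has_derivative_sum has_derivative_mult_right has_derivative_prod
        bounded_linear.has_derivative[OF bounded_linear_vec_nth] has_derivative_ident)
qed

lemma continuous_on_det: "continuous_on S f \<Longrightarrow> continuous_on S (\<lambda>x. det (f x))"
  for f :: "_ \<Rightarrow> real^'n^'n"
  unfolding det_def by (intro continuous_intros)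

lemma continuous_on_adjugate [continuous_intros]:
  "continuous_on S f \<Longrightarrow> continuous_on S (\<lambda>x. adjugate (f x))" for f :: "_ \<Rightarrow> real^'n^'n"
proof -
  assume f: "continuous_on S f"
  have "continuous_on S (\<lambda>x. if i = n then axis k 1 else f x $ i)" for i n k
    using f by (cases "i = n") (auto intro: continuous_on_const continuous_on_component)
  then show ?thesis
    unfolding adjugate_def by (intro continuous_on_vec_lambda continuous_on_det)
qed

subsection \<open>The pairing and functions of the determinant\<close>

lemma duality_pairing_matrix_pairing: "duality_pairing (matrix_pairing :: real^'n^'n \<Rightarrow> _)"
  unfolding duality_pairing_def
proof (intro conjI allI impI)
  show "bilinear (matrix_pairing :: real^'n^'n \<Rightarrow> _)"
    unfolding bilinear_def
    by (auto intro!: linearI simp: matrix_pairing_def algebra_simps sum.distrib sum_distrib_left)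
  \<comment> \<open>Testing against the transpose gives the squared norm, hence nondegeneracy on
    both sides.\<close>
  have e: "matrix_pairing x (transpose x) = x \<bullet> x" "matrix_pairing (transpose x) x = x \<bullet> x"
    for x :: "real^'n^'n"
    unfolding matrix_pairing_def transpose_def inner_vec_def
    by (simp, simp, subst sum.swap, simp)
  show "x = 0" if "\<forall>y. matrix_pairing x y = 0" for x :: "real^'n^'n"
    using that e(1) by (metis inner_eq_zero_iff)
  show "y = 0" if "\<forall>x. matrix_pairing x y = 0" for y :: "real^'n^'n"
    using that e(2) by (metis inner_eq_zero_iff)
qed

lemma bounded_bilinear_matrix_pairing: "bounded_bilinear (matrix_pairing :: real^'n^'n \<Rightarrow> _)"
  using duality_pairing_matrix_pairing[where ?'n='n]
  by (simp add: duality_pairing_def bilinear_conv_bounded_bilinear)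

lemma has_derivative_compose_det:
  assumes "(f has_real_derivative D) (at (det x))"
  shows "((\<lambda>x. f (det x)) has_derivative (\<lambda>h. matrix_pairing h (D *\<^sub>R adjugate x))) (at x)"
proof -
  interpret bounded_bilinear "matrix_pairing :: real^'n^'n \<Rightarrow> _"
    by (rule bounded_bilinear_matrix_pairing)
  show ?thesis
    using has_derivative_compose[OF has_derivative_det assms[unfolded has_field_derivative_def]]
    by (simp add: scaleR_right)
qed

lemma has_dual_derivative_unique:
  fixes x y z :: "real^'n^'n"
  assumes "open \<Omega>" "x \<in> \<Omega>" "has_dual_derivative matrix_pairing \<Omega> F x y"
    and "(F has_derivative (\<lambda>h. matrix_pairing h z)) (at x)"
  shows "y = z"
proof -
  interpret bounded_bilinear "matrix_pairing :: real^'n^'n \<Rightarrow> _"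
    by (rule bounded_bilinear_matrix_pairing)
  have "(F has_derivative (\<lambda>h. matrix_pairing h y)) (at x)"
    using assms(3) at_within_open[OF assms(2,1)] by (simp add: has_dual_derivative_def)
  then have "(\<lambda>h. matrix_pairing h y) = (\<lambda>h. matrix_pairing h z)"
    using assms(4) by (rule has_derivative_unique)
  then have "\<forall>h. matrix_pairing h (y - z) = 0"
    by (simp add: diff_right fun_eq_iff)
  then have "y - z = 0"
    using duality_pairing_matrix_pairing[where ?'n='n] unfolding duality_pairing_def by blast
  then show ?thesis by simp
qed

text \<open>The identity is a global chart, with the whole space as the model subspace.\<close>

lemma open_imp_C1_submanifold:
  fixes S :: "'a::euclidean_space set"
  assumes "open S"
  shows "C1_submanifold S"
proof -
  have id: "C1_on S (\<lambda>x. x)"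
    unfolding C1_on_def using assms
    by (auto intro!: exI[of _ S] exI[of _ "\<lambda>x. x"] exI[of _ "\<lambda>_. id_blinfun"])
  show ?thesis
    unfolding C1_submanifold_def
  proof (intro exI[of _ "DIM('a)"] ballI)
    fix p assume "p \<in> S"
    then show "\<exists>U V L. \<exists>f g :: 'a \<Rightarrow> 'a.
       open U \<and> p \<in> U \<and> open V \<and> homeomorphism U V f g \<and> C1_on U f \<and> C1_on V g \<and>
       subspace L \<and> dim L = DIM('a) \<and> f ` (S \<inter> U) = L \<inter> V"
      using assms id
      by (intro exI[of _ S] exI[of _ UNIV] exI[of _ "\<lambda>x. x"]) (auto simp: homeomorphism_ident)
  qed
qed

lemma C1_on_compose_det:
  fixes \<Omega> :: "(real^'n^'n) set"
  assumes "open \<Omega>"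
    and f: "\<And>x. x \<in> \<Omega> \<Longrightarrow> (f has_real_derivative f' (det x)) (at (det x))"
    and cont: "continuous_on \<Omega> (\<lambda>x. f' (det x))"
  shows "C1_on \<Omega> (\<lambda>x. f (det x))"
proof -
  interpret bounded_bilinear "matrix_pairing :: real^'n^'n \<Rightarrow> _"
    by (rule bounded_bilinear_matrix_pairing)
  define D where "D x = Blinfun (\<lambda>h. matrix_pairing h (f' (det x) *\<^sub>R adjugate x))" for x :: "real^'n^'n"
  have D: "blinfun_apply (D x) = (\<lambda>h. matrix_pairing h (f' (det x) *\<^sub>R adjugate x))" for x
    unfolding D_def by (rule bounded_linear_Blinfun_apply) (rule bounded_linear_left)
  \<comment> \<open>In finite dimension, continuity of an operator-valued map can be checked on each
    basis vector.\<close>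
  have "continuous_on \<Omega> D"
    by (rule continuous_on_blinfun_componentwise)
      (auto simp: D intro!: continuous_on[OF continuous_on_const] continuous_on_scaleR continuous_on_adjugate
        continuous_on_id cont)
  then show ?thesis
    unfolding C1_on_def using assms(1)
    by (auto intro!: exI[of _ \<Omega>] exI[of _ "\<lambda>x. f (det x)"] exI[of _ D]
        simp: D has_derivative_compose_det[OF f])
qed

subsection \<open>The one-dimensional Legendre transform\<close>

text \<open>A continuous injective \<open>q\<close> is strictly monotone on the interval, so its
  value at the mean value point lies between the end values.\<close>

lemma mean_value_injective_derivative:
  fixes f q :: "real \<Rightarrow> real"
  assumes "r < s" and S: "{r..s} \<subseteq> S"
    and f: "\<And>x. x \<in> S \<Longrightarrow> (f has_real_derivative q x) (at x)"
    and cont: "continuous_on S q" and inj: "inj_on q S"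
  obtains z where "f s - f r = (s - r) * q z"
    "\<bar>q r - q z\<bar> \<le> \<bar>q r - q s\<bar>" "\<bar>q s - q z\<bar> \<le> \<bar>q r - q s\<bar>"
proof -
  obtain z where z: "r < z" "z < s" "f s - f r = (s - r) * q z"
    using MVT2[OF \<open>r < s\<close>, of f q] f S by (metis atLeastAtMost_iff subsetD)
  have "q r < q z \<and> q z < q s \<or> q s < q z \<and> q z < q r"
    by (rule continuous_inj_imp_mono[OF z(1,2) continuous_on_subset[OF cont S] inj_on_subset[OF inj S]])
  with z(3) show thesis by (intro that[of z]) auto
qed

text \<open>The quantity inside the absolute value is exactly \<open>(r - s) * (q r - q z)\<close>,
  with z the mean value point.\<close>

lemma legendre_increment_bound:
  fixes f q :: "real \<Rightarrow> real"
  assumes "convex S"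
    and f: "\<And>x. x \<in> S \<Longrightarrow> (f has_real_derivative q x) (at x)"
    and cont: "continuous_on S q" and inj: "inj_on q S" and rs: "r \<in> S" "s \<in> S"
  shows "\<bar>(q r * r - f r) - (q s * s - f s) - s * (q r - q s)\<bar> \<le> \<bar>r - s\<bar> * \<bar>q r - q s\<bar>"
proof -
  have "\<exists>z. f r - f s = (r - s) * q z \<and> \<bar>q r - q z\<bar> \<le> \<bar>q r - q s\<bar>"
  proof (cases r s rule: linorder_cases)
    case less
    have "{r..s} \<subseteq> S"
      using assms(1) rs less by (metis closed_segment_eq_real_ivl1 closed_segment_subset less_imp_le)
    from mean_value_injective_derivative[OF less this f cont inj] show ?thesis
      by (metis minus_diff_eq mult_minus_left)
  next
    case greater
    have "{s..r} \<subseteq> S"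
      using assms(1) rs greater by (metis closed_segment_eq_real_ivl1 closed_segment_subset less_imp_le)
    from mean_value_injective_derivative[OF greater this f cont inj] show ?thesis
      by (metis abs_minus_commute)
  qed auto
  then obtain z where z: "f r - f s = (r - s) * q z" "\<bar>q r - q z\<bar> \<le> \<bar>q r - q s\<bar>" by blast
  have "(q r * r - f r) - (q s * s - f s) - s * (q r - q s) = q r * (r - s) - (f r - f s)"
    by (simp add: algebra_simps)
  also have "\<dots> = (r - s) * (q r - q z)"
    by (simp add: z(1) algebra_simps)
  finally show ?thesis using z(2) by (simp add: abs_mult mult_left_mono)
qed

text \<open>\<open>R\<close> is only continuous, so the chain rule does not apply; only
  \<open>q (R u)\<close> is differentiable. After division by \<open>u - s\<close>, the increment
  bound is a factor tending to 0 times a convergent difference quotient.\<close>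

lemma has_real_derivative_legendre:
  fixes f q R :: "real \<Rightarrow> real"
  assumes "convex S" "open S"
    and f: "\<And>x. x \<in> S \<Longrightarrow> (f has_real_derivative q x) (at x)"
    and cont: "continuous_on S q" and inj: "inj_on q S"
    and R: "isCont R s" "R s \<in> S"
    and D: "((\<lambda>u. q (R u)) has_real_derivative D) (at s)"
  shows "((\<lambda>u. q (R u) * R u - f (R u)) has_real_derivative R s * D) (at s)"
proof -
  let ?g = "\<lambda>u. q (R u) * R u - f (R u)"
  let ?dq = "\<lambda>u. (q (R u) - q (R s)) / (u - s)"
  have dq: "?dq \<midarrow>s\<rightarrow> D"
    using D by (simp add: has_field_derivative_iff)
  have RS: "\<forall>\<^sub>F u in at s. R u \<in> S"
    using R assms(2) by (simp add: isCont_def tendsto_def)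
  have "(\<lambda>u. (?g u - ?g s) / (u - s) - R s * ?dq u) \<midarrow>s\<rightarrow> 0"
  proof (rule Lim_null_comparison)
    show "\<forall>\<^sub>F u in at s. norm ((?g u - ?g s) / (u - s) - R s * ?dq u) \<le> \<bar>R u - R s\<bar> * \<bar>?dq u\<bar>"
      using RS
    proof eventually_elim
      case (elim u)
      have "(?g u - ?g s) / (u - s) - R s * ?dq u
          = (?g u - ?g s - R s * (q (R u) - q (R s))) / (u - s)"
        by (simp flip: diff_divide_distrib)
      then show ?case
        using divide_right_mono[OF legendre_increment_bound[OF assms(1) f cont inj elim R(2)], of "\<bar>u - s\<bar>"]
        by (simp add: abs_divide)
    qed
    have "(\<lambda>u. \<bar>R u - R s\<bar> * \<bar>?dq u\<bar>) \<midarrow>s\<rightarrow> \<bar>R s - R s\<bar> * \<bar>D\<bar>"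
      using R(1) by (intro tendsto_intros dq) (simp add: isCont_def)
    then show "(\<lambda>u. \<bar>R u - R s\<bar> * \<bar>?dq u\<bar>) \<midarrow>s\<rightarrow> 0" by simp
  qed
  from tendsto_add[OF this tendsto_mult[OF tendsto_const[of "R s"] dq]] show ?thesis
    by (simp add: has_field_derivative_iff)
qed

section \<open>The transform as a function of the determinant alone, with \<open>p\<close> as the
  derivative of \<open>\<Phi>\<close>\<close>

locale determinant_profile =
  fixes \<Phi> p \<psi> :: "real \<Rightarrow> real" and a b a' b' :: ereal and N :: nat
  assumes N_pos: "N > 0"
    and deriv: "\<And>t. (\<Phi> has_real_derivative p t) (at t)"
    and isCont_p: "\<And>t. isCont p t"
    and bij: "bij_betw (\<lambda>t. t ^ (N - 1) * p t ^ N) (einterval a b) (einterval a' b')"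
    and inv: "\<And>t. t \<in> einterval a b \<Longrightarrow> \<psi> (t ^ (N - 1) * p t ^ N) = t"
begin

lemma isCont_p_comp: "isCont f x \<Longrightarrow> isCont (\<lambda>x. p (f x)) x"
  by (rule isCont_o2[OF _ isCont_p])

abbreviation "h \<equiv> \<lambda>t. t ^ (N - 1) * p t ^ N"

lemma isCont_h: "isCont h t"
  by (intro continuous_intros isCont_p)

lemma psi:
  assumes "s \<in> einterval a' b'"
  shows "\<psi> s \<in> einterval a b" "h (\<psi> s) = s"
proof -
  obtain t where "t \<in> einterval a b" "s = h t"
    using assms bij by (auto simp: bij_betw_def)
  then show "\<psi> s \<in> einterval a b" "h (\<psi> s) = s" using inv by auto
qed

text \<open>On a compact interval around \<open>\<psi> s\<close> inside (a, b),
  \<open>\<psi>\<close> inverts the continuous \<open>h\<close>, so it is continuous at the image of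
  the midpoint.\<close>

lemma isCont_psi:
  assumes "s \<in> einterval a' b'"
  shows "isCont \<psi> s"
proof -
  let ?t = "\<psi> s"
  obtain e where e: "e > 0" "cball ?t e \<subseteq> einterval a b"
    using psi(1)[OF assms] open_einterval by (metis open_contains_cball)
  have "isCont \<psi> (h ?t)"
  proof (rule isCont_inverse_function2[of "?t - e" ?t "?t + e" \<psi> h])
    show "\<psi> (h z) = z" if "?t - e \<le> z" "z \<le> ?t + e" for z
      using that e inv by (auto simp: cball_eq_atLeastAtMost)
  qed (use e isCont_h in auto)
  then show ?thesis unfolding psi(2)[OF assms] .
qed

abbreviation "g \<equiv> \<lambda>s. real N * p (\<psi> s) * \<psi> s - \<Phi> (\<psi> s)"

text \<open>For N = 1 the function \<open>h\<close> is \<open>p\<close> itself, so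
  \<open>p (\<psi> u) = u\<close> and the one-dimensional transform applies with
  \<open>f = \<Phi>\<close>, \<open>R = \<psi>\<close>.\<close>

lemma has_real_derivative_g_1:
  assumes "s \<in> einterval a' b'" "N = 1"
  shows "(g has_real_derivative \<psi> s) (at s)"
proof -
  have eq: "p (\<psi> u) = u" if "u \<in> einterval a' b'" for u
    using psi(2)[OF that] assms(2) by simp
  have "((\<lambda>u. p (\<psi> u) * \<psi> u - \<Phi> (\<psi> u)) has_real_derivative \<psi> s * 1) (at s)"
  proof (rule has_real_derivative_legendre[where S = "einterval a b"])
    show "convex (einterval a b)"
      by (auto simp: convex_contains_segment closed_segment_eq_real_ivl einterval_iff split: if_splits)
        (meson ereal_less_eq(3) le_less_trans less_le_trans)+
    show "inj_on p (einterval a b)"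
      using bij assms(2) by (simp add: bij_betw_def)
    show "continuous_on (einterval a b) p"
      by (simp add: continuous_at_imp_continuous_on isCont_p)
    show "((\<lambda>u. p (\<psi> u)) has_real_derivative 1) (at s)"
      by (rule has_field_derivative_transform_within_open[OF DERIV_ident open_einterval assms(1)])
        (simp add: eq)
  qed (use assms(1) isCont_psi psi deriv in auto)
  then show ?thesis by (simp add: assms(2))
qed

text \<open>The substitution t = \<open>\<epsilon> r\<^sup>N\<close> turns \<open>\<epsilon>\<close> h(t) into the N-th power of f'(r) / N for the function
  f below.\<close>

lemma has_real_derivative_g_nonzero:
  assumes s: "s \<in> einterval a' b'" "s \<noteq> 0" and N: "N = Suc (Suc m)"
  shows "(g has_real_derivative 1 / (\<psi> s ^ m * p (\<psi> s) ^ Suc m)) (at s)"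
proof -
  define t where "t = \<psi> s"
  have t: "t \<noteq> 0" "p t \<noteq> 0" "t \<in> einterval a b"
    using psi[OF s(1)] s(2) by (auto simp: t_def N)
  \<comment> \<open>The sign makes \<open>\<epsilon> * \<psi> u\<close> positive near s, so it has a
    positive N-th root \<open>R u\<close> whatever the parity of N.\<close>
  define \<epsilon> where "\<epsilon> = sgn t"
  have eps: "\<epsilon> * \<epsilon> = 1" "\<epsilon> * t > 0" "\<epsilon> \<noteq> 0"
    using t(1) by (auto simp: \<epsilon>_def sgn_if)
  define R where "R = (\<lambda>u. root N (\<epsilon> * \<psi> u))"
  define k where "k = (\<lambda>r. \<epsilon> * p (\<epsilon> * r ^ N) * r ^ (N - 1))"
  define f where "f = (\<lambda>r. \<Phi> (\<epsilon> * r ^ N))"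
  define T where "T = einterval a' b' \<inter> (\<lambda>u. \<epsilon> * \<psi> u) -` {0<..}"
  have contR: "isCont R s"
    unfolding R_def by (intro continuous_intros isCont_psi s)
  have openT: "open T"
    unfolding T_def
    by (intro continuous_open_preimage continuous_intros open_einterval open_greaterThan)
      (simp add: continuous_at_imp_continuous_on isCont_psi)
  have sT: "s \<in> T" using s eps by (simp add: T_def t_def)
  have R: "R u > 0" "\<epsilon> * R u ^ N = \<psi> u" if "u \<in> T" for u
  proof -
    from that show "R u > 0" by (simp add: R_def T_def N)
    have "\<epsilon> * R u ^ N = (\<epsilon> * \<epsilon>) * \<psi> u"
      using that by (simp add: R_def T_def real_root_pow_pos2[OF N_pos])
    then show "\<epsilon> * R u ^ N = \<psi> u" by (simp add: eps)
  qed
  have kN: "k r ^ N = \<epsilon> * h (\<epsilon> * r ^ N)" for r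
  proof -
    have "k r ^ N = \<epsilon> ^ N * p (\<epsilon> * r ^ N) ^ N * r ^ ((N - 1) * N)"
      by (simp add: k_def power_mult_distrib power_mult)
    also have "\<epsilon> ^ N = \<epsilon> * \<epsilon> ^ (N - 1)" by (simp add: N)
    finally show ?thesis by (simp add: power_mult_distrib power_mult[symmetric] mult.commute mult.left_commute)
  qed
  \<comment> \<open>The map \<open>z \<mapsto> \<epsilon> * (z / N) ^ N\<close> sends f'(R u) = N
    k(R u) back to u. Thus f'(R u) is differentiable at s by inverting this power, although
    \<open>R\<close> need not be.\<close>
  have Q: "\<epsilon> * (real N * k (R u) / real N) ^ N = u" if "u \<in> T" for u
  proof -
    have "\<epsilon> * k (R u) ^ N = (\<epsilon> * \<epsilon>) * h (\<psi> u)"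
      unfolding kN R(2)[OF that] by simp
    also have "h (\<psi> u) = u" using that psi(2) by (simp add: T_def)
    finally show ?thesis using N_pos eps by simp
  qed
  let ?D = "inverse (\<epsilon> * k (R s) ^ Suc m)"
  have r0: "R s > 0" "k (R s) \<noteq> 0"
    using R[OF sT] t eps by (auto simp: k_def t_def)
  have "open {r. 0 < r \<and> \<epsilon> * r ^ N \<in> einterval a b}"
  proof -
    have "open ({0<..} \<inter> (\<lambda>r. \<epsilon> * r ^ N) -` einterval a b)"
      by (intro continuous_open_preimage continuous_intros) auto
    then show ?thesis by (simp add: vimage_def Int_def)
  qed
  moreover have "R s \<in> {r. 0 < r \<and> \<epsilon> * r ^ N \<in> einterval a b}"
    using R[OF sT] t by (simp add: t_def)
  \<comment> \<open>A ball provides the convex open domain for the one-dimensional lemma; on it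
    \<open>\<epsilon> * r ^ N\<close> stays in (a, b), so injectivity of \<open>h\<close> carries
    over to f'.\<close>
  ultimately obtain e where e: "e > 0" "ball (R s) e \<subseteq> {r. 0 < r \<and> \<epsilon> * r ^ N \<in> einterval a b}"
    by (metis (no_types, lifting) open_contains_ball)
  have "((\<lambda>u. real N * k (R u) * R u - f (R u)) has_real_derivative R s * ?D) (at s)"
  proof (rule has_real_derivative_legendre[where S = "ball (R s) e"])
    show "(f has_real_derivative real N * k x) (at x)" for x
    proof -
      have "((\<lambda>r. \<epsilon> * r ^ N) has_real_derivative \<epsilon> * (real N * x ^ (N - 1))) (at x)"
        by (auto intro!: derivative_eq_intros)
      from DERIV_chain2[OF deriv this] show ?thesis
        by (simp add: f_def k_def mult_ac)
    qed
    show "continuous_on (ball (R s) e) (\<lambda>x. real N * k x)"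
      unfolding k_def
      by (intro continuous_at_imp_continuous_on ballI continuous_intros isCont_p_comp)
    show "inj_on (\<lambda>x. real N * k x) (ball (R s) e)"
    proof (rule inj_onI)
      fix x y assume xy: "x \<in> ball (R s) e" "y \<in> ball (R s) e" "real N * k x = real N * k y"
      then have "k x ^ N = k y ^ N" using N_pos by simp
      then have "h (\<epsilon> * x ^ N) = h (\<epsilon> * y ^ N)" unfolding kN using eps by simp
      moreover have pos: "\<epsilon> * x ^ N \<in> einterval a b" "\<epsilon> * y ^ N \<in> einterval a b" "x > 0" "y > 0"
        using xy(1,2) e(2) by auto
      ultimately have "\<epsilon> * x ^ N = \<epsilon> * y ^ N" using inv by metis
      then show "x = y" using eps pos N_pos by (auto intro: power_eq_imp_eq_base)
    qed
    show "((\<lambda>u. real N * k (R u)) has_real_derivative ?D) (at s)"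
    proof (rule has_field_derivative_inverse_basic[where f = "\<lambda>z. \<epsilon> * (z / real N) ^ N" and t = T])
      show "((\<lambda>z. \<epsilon> * (z / real N) ^ N) has_real_derivative \<epsilon> * k (R s) ^ Suc m)
          (at (real N * k (R s)))"
        by (rule DERIV_cong[OF DERIV_cmult[OF DERIV_power[OF DERIV_cdivide[OF DERIV_ident]]]])
          (simp add: N del: of_nat_Suc)
      show "isCont (\<lambda>u. real N * k (R u)) s"
        unfolding k_def by (intro continuous_intros contR isCont_p_comp)
    qed (use eps r0 openT sT Q in auto)
  qed (use e contR in auto)
  moreover have "R s * ?D = 1 / (t ^ m * p t ^ Suc m)"
  proof -
    have "k (R s) ^ Suc m = \<epsilon> * \<epsilon> ^ m * p t ^ Suc m * R s ^ ((N - 1) * Suc m)"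
      unfolding k_def power_mult_distrib R(2)[OF sT] power_mult by (simp add: t_def)
    \<comment> \<open>Since N = m + 2, the exponent is (m + 1)^2 = 1 + N m. One factor
      \<open>R s\<close> cancels, and the others combine with \<open>\<epsilon>\<close> into powers
      of t.\<close>
    moreover have "R s ^ ((N - 1) * Suc m) = R s * (R s ^ N) ^ m"
      by (simp add: N algebra_simps flip: power_mult power_add power_Suc)
    ultimately have "\<epsilon> * k (R s) ^ Suc m = (\<epsilon> * \<epsilon>) * \<epsilon> ^ m * p t ^ Suc m * R s * (R s ^ N) ^ m"
      by (simp only: mult_ac)
    also have "\<dots> = R s * ((\<epsilon> * R s ^ N) ^ m * p t ^ Suc m)"
      by (simp only: power_mult_distrib eps mult_ac mult_1)
    finally show ?thesis using r0 R(2)[OF sT] by (simp add: t_def divide_inverse)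
  qed
  ultimately have "((\<lambda>u. real N * k (R u) * R u - f (R u)) has_real_derivative
      1 / (t ^ m * p t ^ Suc m)) (at s)" by simp
  then show ?thesis
    unfolding t_def
  proof (rule has_field_derivative_transform_within_open[OF _ openT sT])
    fix u assume u: "u \<in> T"
    have "k (R u) * R u = p (\<epsilon> * R u ^ N) * (\<epsilon> * R u ^ N)"
      by (simp add: k_def N)
    then show "real N * k (R u) * R u - f (R u) = g u"
      by (simp add: f_def R(2)[OF u] mult.assoc)
  qed
qed

text \<open>If N = 2 and p has a zero t apart from 0, then h has a local extremum at t and cannot be
  injective.\<close>

lemma psi_zero:
  assumes "N = 2" "p 0 \<noteq> 0" "0 \<in> einterval a' b'"
  shows "\<psi> 0 = 0"
proof (rule ccontr)
  let ?t = "\<psi> 0"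
  assume t: "?t \<noteq> 0"
  have "open (einterval a b - {0})" "?t \<in> einterval a b - {0}"
    using psi[OF assms(3)] t by auto
  then obtain e where e: "e > 0" "cball ?t e \<subseteq> einterval a b - {0}"
    by (metis open_contains_cball)
  let ?x = "?t - e" and ?y = "?t + e"
  have sub: "{?x..?y} \<subseteq> einterval a b - {0}"
    using e(2) by (simp add: cball_eq_atLeastAtMost)
  have "h ?x < h ?t \<and> h ?t < h ?y \<or> h ?y < h ?t \<and> h ?t < h ?x"
  proof (rule continuous_inj_imp_mono[of ?x ?t ?y h])
    show "continuous_on {?x..?y} h"
      using isCont_h by (simp add: continuous_at_imp_continuous_on)
    show "inj_on h {?x..?y}"
      using sub bij by (auto simp: bij_betw_def intro: inj_on_subset)
  qed (use e in auto)
  \<comment> \<open>For N = 2, \<open>h t = t * p t ^ 2\<close> never has the sign opposite to t, so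
    a sign change of \<open>h\<close> across the interval puts 0 inside it.\<close>
  then have "h ?x < 0 \<and> 0 < h ?y \<or> h ?y < 0 \<and> 0 < h ?x"
    unfolding psi(2)[OF assms(3)] .
  then have "?x < 0 \<and> 0 < ?y \<or> ?y < 0 \<and> 0 < ?x"
    by (auto simp: assms(1) mult_less_0_iff zero_less_mult_iff power2_eq_square)
  then have "0 \<in> {?x..?y}" using e(1) by auto
  with sub show False by blast
qed

text \<open>Here \<open>\<psi> 0 = 0\<close>, and the factor t makes both \<open>h\<close> and
  \<open>t * p t\<close> differentiable at 0 although \<open>p\<close> is only continuous. As h'(0)
  = \<open>p 0 ^ 2\<close> is nonzero, \<open>\<psi>\<close> is differentiable at 0 and the chain
  rule applies.\<close>

lemma has_real_derivative_g_2:
  assumes "N = 2" "p 0 \<noteq> 0" "0 \<in> einterval a' b'"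
  shows "(g has_real_derivative 1 / p 0) (at 0)"
proof -
  have psi0: "\<psi> 0 = 0" by (rule psi_zero[OF assms])
  \<comment> \<open>Caratheodory's criterion: the difference quotient of \<open>t * c t\<close> at 0
    is \<open>c t\<close>.\<close>
  have mul: "((\<lambda>t. t * c t) has_real_derivative c 0) (at 0)" if "isCont c 0" for c
    unfolding CARAT_DERIV using that by (auto intro!: exI[of _ c])
  have "isCont (\<lambda>t. p t ^ 2) 0" by (intro continuous_intros isCont_p)
  from mul[OF this] have "(h has_real_derivative p 0 ^ 2) (at (\<psi> 0))"
    by (simp add: assms(1) psi0)
  then have "(\<psi> has_real_derivative inverse (p 0 ^ 2)) (at 0)"
    by (rule has_field_derivative_inverse_basic[where t = "einterval a' b'"])
      (use assms psi(2) in \<open>auto intro: isCont_psi\<close>)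
  note d = this
  have 1: "((\<lambda>t. 2 * (t * p t) - \<Phi> t) has_real_derivative 2 * p 0 - p 0) (at (\<psi> 0))"
    unfolding psi0 by (intro DERIV_diff DERIV_cmult mul isCont_p deriv)
  have "((\<lambda>s. 2 * (\<psi> s * p (\<psi> s)) - \<Phi> (\<psi> s)) has_real_derivative
      (2 * p 0 - p 0) * inverse (p 0 ^ 2)) (at 0)"
    by (rule DERIV_chain2[OF 1 d])
  then show ?thesis
    using assms(2) by (simp add: assms(1) power2_eq_square mult_ac inverse_eq_divide)
qed

text \<open>The factor for which x = g'(det y) adj y when y = p(t) adj x is invertible: for N > 1,
  adj y = p(t)^(N-1) t^(N-2) x. For N = 1 the adjugate is constant, so that case is
  separate.\<close>

definition "g' s = (if N = 1 then \<psi> s else 1 / (\<psi> s ^ (N - 2) * p (\<psi> s) ^ (N - 1)))"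

text \<open>Keeps the denominator of \<open>g'\<close> nonzero: for s \<noteq> 0 the equation
  \<open>h (\<psi> s) = s\<close> does so, and at s = 0 with N > 1 only N = 2 with
  \<open>p 0 \<noteq> 0\<close> remains.\<close>

context
  assumes regular: "0 \<notin> einterval a' b' \<or> N = 1 \<or> N = 2 \<and> p 0 \<noteq> 0"
begin

lemma has_real_derivative_g:
  assumes s: "s \<in> einterval a' b'"
  shows "(g has_real_derivative g' s) (at s)"
proof (cases "N = 1")
  case True
  with has_real_derivative_g_1[OF s] show ?thesis unfolding g'_def by simp
next
  case False
  then obtain m where N: "N = Suc (Suc m)"
    using N_pos by (metis One_nat_def Suc_pred not0_implies_Suc gr0_conv_Suc)
  show ?thesis
  proof (cases "s = 0")
    case True
    then have "N = 2" "p 0 \<noteq> 0" "\<psi> 0 = 0" using regular s False psi_zero by auto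
    with True s show ?thesis
      using has_real_derivative_g_2 unfolding g'_def by simp
  next
    case False
    then show ?thesis
      using has_real_derivative_g_nonzero[OF s _ N] unfolding g'_def by (simp add: N)
  qed
qed

lemma continuous_on_g': "continuous_on (einterval a' b') g'"
proof (cases "N = 1")
  case True
  then show ?thesis
    unfolding g'_def by (simp add: continuous_at_imp_continuous_on isCont_psi)
next
  case False
  have nz: "\<psi> s ^ (N - 2) * p (\<psi> s) ^ (N - 1) \<noteq> 0" if "s \<in> einterval a' b'" for s
  proof (cases "s = 0")
    case True
    then have "N = 2" "p 0 \<noteq> 0" "\<psi> 0 = 0" using regular that False psi_zero by auto
    then show ?thesis by (simp add: True)
  next
    case s: False
    then have "h (\<psi> s) \<noteq> 0" unfolding psi(2)[OF that] .
    then have "\<psi> s ^ (N - 1) \<noteq> 0" "p (\<psi> s) ^ N \<noteq> 0" by simp_all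
    with N_pos False show ?thesis by simp
  qed
  have "isCont (\<lambda>s. 1 / (\<psi> s ^ (N - 2) * p (\<psi> s) ^ (N - 1))) s" if "s \<in> einterval a' b'" for s
    by (intro continuous_intros isCont_psi isCont_p_comp that nz)
  then show ?thesis
    using False by (simp add: g'_def[abs_def] continuous_at_imp_continuous_on)
qed

end

end

subsection \<open>Surjectivity of the derivative\<close>

text \<open>Used with t = \<open>\<psi> (det y)\<close> and c the derivative of
  \<open>\<Phi>\<close> at t, this produces a point x at which the derivative of F is y.\<close>

lemma ex_adjugate_eq:
  fixes y :: "real^'n^'n"
  assumes det: "t ^ (CARD('n) - 1) * c ^ CARD('n) = det y"
    and nz: "det y \<noteq> 0 \<or> CARD('n) = 1 \<or> CARD('n) = 2 \<and> t = 0 \<and> c \<noteq> 0"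
  obtains x where "det x = t" "c *\<^sub>R adjugate x = y"
proof -
  consider "CARD('n) = 1" | "CARD('n) = 2" "t = 0" "c \<noteq> 0" | "CARD('n) \<noteq> 1" "det y \<noteq> 0"
    using nz by blast
  then show thesis
  proof cases
    case 1
    have "y = det y *\<^sub>R mat 1"
      using matrix_mul_adjugate[of y] by (simp add: adjugate_card_1[OF 1])
    then show thesis
      using 1 det by (intro that[of "t *\<^sub>R mat 1"]) (auto simp: det_scaleR adjugate_card_1)
  next
    case 2
    then have "det y = 0" using det by simp
    \<comment> \<open>The witness inverts \<open>c *\<^sub>R adjugate x\<close> using that the
      adjugate is a linear involution in size 2.\<close>
    then show thesis
      using 2 by (intro that[of "inverse c *\<^sub>R adjugate y"])
        (simp_all add: det_scaleR det_adjugate adjugate_scaleR_adjugate_card_2)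
  next
    case 3
    obtain m where m: "CARD('n) = Suc (Suc m)"
      using 3(1) by (metis One_nat_def not0_implies_Suc zero_less_card_finite less_irrefl)
    have nz: "t \<noteq> 0" "c \<noteq> 0" using 3(2) det[symmetric] by (auto simp: m)
    \<comment> \<open>For invertible x, c adj x = c t x^(-1) must equal y, which forces x = t c
      y^(-1). The hypothesis on \<open>det y\<close> then gives det x = t.\<close>
    obtain z where z: "z ** y = mat 1"
      using 3(2) by (metis invertible_det_nz invertible_def)
    have "det z * det y = 1" by (metis det_I det_mul z)
    then have "(t * c) ^ CARD('n) * det z = t * (det z * det y)"
      unfolding det[symmetric] by (simp add: m power_mult_distrib mult_ac)
    then have t: "det ((t * c) *\<^sub>R z) = t"
      using \<open>det z * det y = 1\<close> by (simp add: det_scaleR)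
    have "((t * c) *\<^sub>R z) ** (inverse c *\<^sub>R y) = (t * c * inverse c) *\<^sub>R (z ** y)"
      by (simp add: matrix_scalar_ac mult_ac flip: scalar_matrix_assoc)
    then have "adjugate ((t * c) *\<^sub>R z) = inverse c *\<^sub>R y"
      using nz by (intro adjugate_eqI) (simp_all add: t z)
    with t nz show thesis by (intro that[of "(t * c) *\<^sub>R z"]) simp_all
  qed
qed

text \<open>The first part is the pointwise identity; for the transform, F' must also reach all of
  \<open>\<Sigma>\<close>. If 0 lies in (a', b'), then \<open>\<Sigma>\<close> contains every
  singular matrix, while the singular values of F' have rank at most 1, and are 0 if N = 2 and the
  derivative of \<open>\<Phi>\<close> vanishes at 0. So for N > 1 with 0 in (a', b'), only N = 2
  with nonzero derivative at 0 remains.\<close>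

theorem proposition1:
  fixes \<Phi> \<psi> h :: "real \<Rightarrow> real" and a b a' b' :: ereal
    and \<Omega> \<Sigma> :: "(real^'n^'n) set" and F G :: "real^'n^'n \<Rightarrow> real"
  defines "h \<equiv> \<lambda>t. t ^ (CARD('n) - 1) * deriv \<Phi> t ^ CARD('n)"
    and "\<Omega> \<equiv> {x. det x \<in> einterval a b}"
    and "\<Sigma> \<equiv> {y. det y \<in> einterval a' b'}"
    and "F \<equiv> \<lambda>x. \<Phi> (det x)"
    and "G \<equiv> \<lambda>y. real CARD('n) * deriv \<Phi> (\<psi> (det y)) * \<psi> (det y) - \<Phi> (\<psi> (det y))"
  assumes C1: "\<Phi> C1_differentiable_on UNIV"
    and ab: "a < b"
    and bij: "bij_betw h (einterval a b) (einterval a' b')"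
    and inv: "\<forall>t\<in>einterval a b. \<psi> (h t) = t"
  shows "(\<forall>x\<in>\<Omega>. \<exists>y\<in>\<Sigma>. has_dual_derivative matrix_pairing \<Omega> F x y \<and>
            matrix_pairing x y - F x = G y) \<and>
         (0 \<notin> einterval a' b' \<or> CARD('n) = 1 \<or> CARD('n) = 2 \<and> deriv \<Phi> 0 \<noteq> 0 \<longrightarrow>
            legendre_transform matrix_pairing \<Omega> F \<Sigma> G)"
proof -
  obtain D where D: "\<And>t. (\<Phi> has_real_derivative D t) (at t)" "continuous_on UNIV D"
    using C1 by (auto simp: C1_differentiable_on_def has_real_derivative_iff_has_vector_derivative)
  have "deriv \<Phi> = D" using D(1) by (auto intro: DERIV_imp_deriv)
  then have d\<Phi>: "(\<Phi> has_real_derivative deriv \<Phi> t) (at t)"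
    and cont: "continuous_on UNIV (deriv \<Phi>)" for t
    using D by auto
  interpret P: determinant_profile \<Phi> "deriv \<Phi>" \<psi> a b a' b' "CARD('n)"
    using d\<Phi> cont bij inv
    by unfold_locales (auto simp: h_def continuous_on_eq_continuous_at)
  have op: "open \<Omega>" "open \<Sigma>"
    unfolding \<Omega>_def \<Sigma>_def
    using continuous_open_preimage[OF continuous_on_det[OF continuous_on_id] open_UNIV open_einterval]
    by (auto simp: vimage_def)
  define Y where "Y x = deriv \<Phi> (det x) *\<^sub>R adjugate x" for x :: "real^'n^'n"
  have dF: "(F has_derivative (\<lambda>h. matrix_pairing h (Y x))) (at x)" for x
    unfolding F_def Y_def by (rule has_derivative_compose_det[OF d\<Phi>])
  then have dual: "has_dual_derivative matrix_pairing \<Omega> F x (Y x)" for x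
    by (simp add: has_dual_derivative_def has_derivative_at_withinI)
  have uniq: "y = Y x" if "x \<in> \<Omega>" "has_dual_derivative matrix_pairing \<Omega> F x y" for x y
    using has_dual_derivative_unique[OF op(1) that dF] .
  have detY: "det (Y x) = h (det x)" for x
    by (simp add: Y_def det_scaleR det_adjugate h_def mult.commute)
  have Y: "Y x \<in> \<Sigma>" "matrix_pairing x (Y x) - F x = G (Y x)" if "x \<in> \<Omega>" for x
  proof -
    have x: "det x \<in> einterval a b" using that by (simp add: \<Omega>_def)
    with bij show "Y x \<in> \<Sigma>"
      by (auto simp: \<Sigma>_def detY bij_betw_def)
    have "matrix_pairing x (Y x) = deriv \<Phi> (det x) * matrix_pairing x (adjugate x)"
      unfolding Y_def
      by (rule bounded_bilinear.scaleR_right[OF bounded_bilinear_matrix_pairing, unfolded real_scaleR_def])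
    then show "matrix_pairing x (Y x) - F x = G (Y x)"
      using inv x by (simp add: G_def F_def detY matrix_pairing_adjugate)
  qed
  have "legendre_transform matrix_pairing \<Omega> F \<Sigma> G"
    if reg: "0 \<notin> einterval a' b' \<or> CARD('n) = 1 \<or> CARD('n) = 2 \<and> deriv \<Phi> 0 \<noteq> 0"
    unfolding legendre_transform_def
  proof (intro conjI allI impI)
    show "C1_on \<Omega> F"
      unfolding F_def
      by (rule C1_on_compose_det[where f' = "deriv \<Phi>"])
        (auto intro: op d\<Phi> continuous_on_compose2[OF cont continuous_on_det[OF continuous_on_id]])
    show "C1_on \<Sigma> G"
      unfolding G_def
    proof (rule C1_on_compose_det[where f' = P.g'])
      show "continuous_on \<Sigma> (\<lambda>x. P.g' (det x))"
        by (rule continuous_on_compose2[OF P.continuous_on_g'[OF reg]])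
          (auto simp: \<Sigma>_def intro: continuous_on_det continuous_on_id)
      show "((\<lambda>s. real CARD('n) * deriv \<Phi> (\<psi> s) * \<psi> s - \<Phi> (\<psi> s))
          has_real_derivative P.g' (det y)) (at (det y))" if "y \<in> \<Sigma>" for y
        using that P.has_real_derivative_g[OF reg] by (simp add: \<Sigma>_def)
    qed (rule op)
    show "\<Sigma> = {y. \<exists>x\<in>\<Omega>. has_dual_derivative matrix_pairing \<Omega> F x y}"
    proof (intro equalityI subsetI)
      fix y assume "y \<in> \<Sigma>"
      then have s: "det y \<in> einterval a' b'" by (simp add: \<Sigma>_def)
      \<comment> \<open>For singular y and N = 2, \<open>psi_zero\<close> places the preimage at
        determinant 0.\<close>
      have "det y \<noteq> 0 \<or> CARD('n) = 1 \<or>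
          CARD('n) = 2 \<and> \<psi> (det y) = 0 \<and> deriv \<Phi> (\<psi> (det y)) \<noteq> 0"
        using reg s P.psi_zero by fastforce
      with P.psi(2)[OF s] obtain x where x: "det x = \<psi> (det y)" "deriv \<Phi> (\<psi> (det y)) *\<^sub>R adjugate x = y"
        by (rule ex_adjugate_eq)
      then have "x \<in> \<Omega>" "y = Y x" using P.psi(1)[OF s] by (auto simp: \<Omega>_def Y_def)
      with dual show "y \<in> {y. \<exists>x\<in>\<Omega>. has_dual_derivative matrix_pairing \<Omega> F x y}" by blast
    next
      fix y assume "y \<in> {y. \<exists>x\<in>\<Omega>. has_dual_derivative matrix_pairing \<Omega> F x y}"
      then show "y \<in> \<Sigma>" using uniq Y(1) by blast
    qed
    show "matrix_pairing x y - F x = G y"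
      if "x \<in> \<Omega> \<and> has_dual_derivative matrix_pairing \<Omega> F x y" for x y
      using that uniq Y(2) by blast
  qed (auto intro: duality_pairing_matrix_pairing open_imp_C1_submanifold op)
  with dual Y show ?thesis by blast
qed

end
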